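(* Let $p\equiv 1\pmod 6$ be a prime. Then $$\sum_{x\in\mathbb{F}_p}\chi\left(x^{3}+1\right)\equiv 4\pmod 6.$$
   Context: $\chi$ denotes the Legendre symbol modulo $p$: $\chi(u)=1$ if $u$ is a nonzero square in $\mathbb{F}_p$, $\chi(u)=-1$ if $u$ is a non-square, and $\chi(0)=0$. *)

theory Defs
  imports "HOL-Number_Theory.Number_Theory"
begin

end

theory Submission
  imports Defs
begin

text \<open>
  Write \<open>p = 6 * n + 1\<close> and let \<open>g\<close> be a primitive root. Putting \<open>x = g ^ k\<close> for \<open>x \<noteq> 0\<close>,
  the cube \<open>g ^ (3 * k)\<close> has period \<open>2 * n\<close> in \<open>k\<close>, so the sum equals \<open>1 + 3 * T\<close> with
  \<open>T\<close> the sum of \<open>\<chi> (g ^ (3 * k) + 1)\<close> over \<open>k < 2 * n\<close>. Exactly one of these \<open>2 * n\<close> terms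
  vanishes, namely \<open>k = n\<close>, and the others are odd; so \<open>T\<close> is odd.
\<close>

lemma Legendre_cong:
  assumes "[a = b] (mod p)"
  shows "Legendre a p = Legendre b p"
proof -
  have "[c = a] (mod p) \<longleftrightarrow> [c = b] (mod p)" for c
    using assms cong_sym cong_trans by blast
  moreover have "[a = 0] (mod p) \<longleftrightarrow> [b = 0] (mod p)"
    using assms cong_sym cong_trans by blast
  ultimately show ?thesis
    by (simp add: Legendre_def QuadRes_def)
qed

text \<open>Both nonzero values 1 and -1 are odd, so modulo 2 the symbol only detects divisibility.
  This turns the parity of a character sum into a count of nonzero terms.\<close>

lemma Legendre_mod_2: "[Legendre a p = of_bool (\<not> p dvd a)] (mod 2)"
  by (auto simp: Legendre_def cong_0_iff cong_def)

lemma Legendre_1: "prime p \<Longrightarrow> Legendre 1 p = 1"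
  by (auto simp: Legendre_def QuadRes_def cong_0_iff intro: exI[of _ 1])

text \<open>With \<open>h = (p - 1) div 2\<close>, the power \<open>g ^ h\<close> is a square root
  of 1 modulo a prime, hence 1 or -1. The value 1 is excluded because \<open>0 < h < p - 1\<close>
  and \<open>g\<close> has order \<open>p - 1\<close>.\<close>

lemma residue_primroot_half_power:
  assumes "prime p" "odd p" "residue_primroot p g"
  shows "[int g ^ ((p - 1) div 2) = -1] (mod int p)"
proof -
  define h where "h = (p - 1) div 2"
  have p: "p > 2" using assms(1,2) prime_ge_2_nat[of p] by (cases "p = 2") auto
  have ord: "ord p g = p - 1"
    using assms by (simp add: residue_primroot_def totient_prime)
  have h: "2 * h = p - 1" "0 < h" "h < p - 1"
    using assms(2) p by (auto simp: h_def)
  have "\<not> [g ^ h = 1] (mod p)"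
    using h(2,3) by (simp only: ord_divides ord) (auto dest: dvd_imp_le)
  hence "\<not> int p dvd int g ^ h - 1"
    unfolding cong_int_iff[symmetric] by (simp add: cong_iff_dvd_diff)
  moreover have "[g ^ (2 * h) = 1] (mod p)"
    by (simp only: ord_divides ord h(1) dvd_refl)
  hence "int p dvd int g ^ (2 * h) - 1"
    unfolding cong_int_iff[symmetric] by (simp add: cong_iff_dvd_diff)
  hence "int p dvd (int g ^ h - 1) * (int g ^ h + 1)"
    by (simp add: algebra_simps power_mult power_mult_distrib power2_eq_square mult_2 power_add)
  ultimately have "int p dvd int g ^ h + 1"
    using assms(1) by (simp add: prime_dvd_mult_iff)
  thus ?thesis by (simp add: cong_iff_dvd_diff h_def)
qed

text \<open>The range splits into \<open>d\<close> consecutive blocks of length \<open>m\<close>,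
  each a shift of the first by a multiple of the period.\<close>

lemma sum_lessThan_mult_periodic:
  fixes f :: "nat \<Rightarrow> 'a::semiring_1"
  assumes "\<And>k. f (k + m) = f k"
  shows "sum f {..<d * m} = of_nat d * sum f {..<m}"
proof (induction d)
  case (Suc d)
  have *: "f (k + d * m) = f k" for k
  proof (induction d)
    case (Suc d)
    thus ?case using assms[of "k + d * m"] by (simp add: algebra_simps)
  qed simp
  have "sum f {..<Suc d * m} = sum f {..<d * m} + (\<Sum>k<m. f (k + d * m))"
    using sum.atLeastLessThan_concat[of 0 "d * m" "m + d * m" f]
      sum.shift_bounds_nat_ivl[of f 0 "d * m" m]
    by (simp add: atLeast0LessThan)
  thus ?case by (simp add: * Suc.IH algebra_simps)
qed simp

theorem theorem12:
  fixes p :: nat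
  assumes "prime p" and "[p = 1] (mod 6)"
  shows "[(\<Sum>x\<in>{0..<int p}. Legendre (x ^ 3 + 1) (int p)) = 4] (mod 6)"
proof -
  define n where "n = p div 6"
  have p: "p = 6 * n + 1"
    using assms(2) by (simp add: n_def cong_def) presburger
  have "n > 0" using assms(1) p by (cases n) auto
  obtain g where g: "residue_primroot p g"
    using prime_primitive_root_exists[of p] assms(1) prime_gt_1_nat by blast
  have ord: "ord p g = 6 * n" and cop: "coprime p g"
    using g assms(1) p by (auto simp: residue_primroot_def totient_prime)
  define F where "F x = Legendre (x ^ 3 + 1) (int p)" for x :: int
  define f where "f k = F (int g ^ k)" for k
  have F_cong: "F x = F y" if "[x = y] (mod int p)" for x y
    unfolding F_def by (intro Legendre_cong cong_add cong_pow that cong_refl)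
  have bij: "bij_betw (\<lambda>k. g ^ k mod p) {..<6 * n} {0<..<p}"
    using residue_primroot_is_generator[OF _ g] assms(1) prime_gt_1_nat[of p] p
    by (simp add: totatives_prime totient_prime)

  have "(\<Sum>x\<in>{0..<int p}. F x) = (\<Sum>x<p. F (int x))"
    by (intro sum.reindex_bij_witness[of _ int nat]) auto
  also have "{..<p} = insert 0 {0<..<p}" using p by auto
  also have "(\<Sum>x\<in>\<dots>. F (int x)) = F 0 + (\<Sum>x\<in>{0<..<p}. F (int x))"
    by simp
  also have "F 0 = 1"
    using assms(1) by (simp add: F_def Legendre_1)
  also have "(\<Sum>x\<in>{0<..<p}. F (int x)) = (\<Sum>k<6 * n. F (int (g ^ k mod p)))"
    by (rule sum.reindex_bij_betw[OF bij, symmetric])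
  also have "\<dots> = sum f {..<3 * (2 * n)}"
    unfolding f_def by (intro sum.cong F_cong) (auto simp: of_nat_mod)
  also have "\<dots> = 3 * sum f {..<2 * n}"
  proof (subst sum_lessThan_mult_periodic)
    fix k
    \<comment> \<open>The two exponents differ by \<open>6 * n\<close>, the order of
      \<open>g\<close>.\<close>
    have "[g ^ (3 * (k + 2 * n)) = g ^ (3 * k)] (mod p)"
      by (subst order_divides_expdiff[OF cop])
         (simp add: ord cong_def algebra_simps)
    hence "[(int g ^ (k + 2 * n)) ^ 3 = (int g ^ k) ^ 3] (mod int p)"
      unfolding cong_int_iff[symmetric] by (simp add: mult.commute flip: power_mult)
    thus "f (k + 2 * n) = f k"
      unfolding f_def F_def by (intro Legendre_cong cong_add cong_refl)
  qed simp
  finally have S: "(\<Sum>x\<in>{0..<int p}. F x) = 1 + 3 * sum f {..<2 * n}" .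

  \<comment> \<open>Here \<open>(p - 1) div 2 = 3 * n\<close>.\<close>
  have half: "[int g ^ (3 * n) = -1] (mod int p)"
    using residue_primroot_half_power[OF assms(1) _ g] p by simp
  have zero: "int p dvd (int g ^ k) ^ 3 + 1 \<longleftrightarrow> k = n" if "k < 2 * n" for k
  proof -
    have "int p dvd (int g ^ k) ^ 3 + 1 \<longleftrightarrow> [int g ^ (3 * k) = -1] (mod int p)"
      by (simp add: cong_iff_dvd_diff mult.commute flip: power_mult)
    also have "\<dots> \<longleftrightarrow> [int g ^ (3 * k) = int g ^ (3 * n)] (mod int p)"
      using half cong_sym cong_trans by blast
    also have "\<dots> \<longleftrightarrow> [g ^ (3 * k) = g ^ (3 * n)] (mod p)"
      by (simp flip: cong_int_iff)
    also have "\<dots> \<longleftrightarrow> [3 * k = 3 * n] (mod (6 * n))"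
      by (simp add: order_divides_expdiff[OF cop] ord)
    \<comment> \<open>Both \<open>3 * k\<close> and \<open>3 * n\<close> lie below the modulus
      \<open>6 * n\<close>, so the congruence is an equality.\<close>
    also have "\<dots> \<longleftrightarrow> k = n"
      using that \<open>n > 0\<close> by (simp add: cong_def)
    finally show ?thesis .
  qed
  have "[sum f {..<2 * n} = (\<Sum>k<2 * n. of_bool (k \<noteq> n))] (mod 2)"
  proof (rule cong_sum)
    fix k assume "k \<in> {..<2 * n}"
    thus "[f k = of_bool (k \<noteq> n)] (mod 2)"
      using Legendre_mod_2[of "(int g ^ k) ^ 3 + 1" "int p"] zero[of k]
      by (simp add: f_def F_def)
  qed
  \<comment> \<open>The index \<open>n\<close> lies in the range as \<open>n > 0\<close>; removing
    it leaves an odd number of odd terms.\<close>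
  also have "(\<Sum>k<2 * n. of_bool (k \<noteq> n)) = int (card ({..<2 * n} - {n}))"
    by (subst sum_of_bool_eq) (auto intro!: arg_cong[of _ _ card])
  also have "\<dots> = 2 * int n - 1"
    using \<open>n > 0\<close> by (simp add: card_Diff_singleton_if of_nat_diff)
  finally have "odd (sum f {..<2 * n})"
    by (simp add: cong_def) presburger
  then obtain t where "sum f {..<2 * n} = 2 * t + 1" by (elim oddE)
  \<comment> \<open>\<open>1 + 3 * (2 * t + 1) = 4 + 6 * t\<close>.\<close>
  hence "(\<Sum>x\<in>{0..<int p}. F x) = 4 + 6 * t" using S by simp
  thus ?thesis by (simp add: F_def cong_def)
qed

end
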